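(* For all integers $n\geq 0$, \[ B_{243,17}(81n+23)\equiv 0\pmod{17}\quad\text{and}\quad B_{243,17}(81n+77)\equiv 0\pmod{17}. \]
   Context: For integers $s,t>1$, an $(s,t)$-regular bipartition of $n$ is a pair $(\lambda,\mu)$ of partitions with total sum of parts $n$ such that no part of $\lambda$ is divisible by $s$ and no part of $\mu$ is divisible by $t$. $B_{s,t}(n)$ denotes the number of $(s,t)$-regular bipartitions of $n$; equivalently $\sum_{n\geq0}B_{s,t}(n)q^n=\frac{f_sf_t}{f_1^2}$, where $f_k=\prod_{m\geq1}(1-q^{mk})$. *)

theory Defs
  imports "HOL-Library.Multiset" "HOL-Number_Theory.Cong"
begin

text \<open>A partition is the multiset of its parts, which are positive.\<close>

definition is_partition :: "nat multiset \<Rightarrow> bool" where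
  "is_partition p \<longleftrightarrow> 0 \<notin># p"

definition regular_bipartitions :: "nat \<Rightarrow> nat \<Rightarrow> nat \<Rightarrow> (nat multiset \<times> nat multiset) set" where
  "regular_bipartitions s t n =
     {(p, r). is_partition p \<and> is_partition r \<and>
              sum_mset p + sum_mset r = n \<and>
              (\<forall>x\<in>#p. \<not> s dvd x) \<and> (\<forall>x\<in>#r. \<not> t dvd x)}"

definition B :: "nat \<Rightarrow> nat \<Rightarrow> nat \<Rightarrow> nat" where
  "B s t n = card (regular_bipartitions s t n)"

text \<open>The set counted by \<^const>\<open>B\<close> is finite, so \<^const>\<open>card\<close> is its number of elements.\<close>

lemma finite_partitions_le: "finite {p. is_partition p \<and> sum_mset p \<le> n}"
proof -
  have size_le: "size p \<le> sum_mset p" if "0 \<notin># p" for p :: "nat multiset"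
    using that by (induction p) auto
  have part_le: "x \<le> sum_mset p" if "x \<in># p" for x and p :: "nat multiset"
    using that by (induction p) auto
  have "{p. is_partition p \<and> sum_mset p \<le> n} \<subseteq> mset ` {xs. set xs \<subseteq> {..n} \<and> length xs \<le> n}"
  proof
    fix p assume "p \<in> {p. is_partition p \<and> sum_mset p \<le> n}"
    then have p: "0 \<notin># p" "sum_mset p \<le> n" by (auto simp: is_partition_def)
    obtain xs where xs: "p = mset xs" by (metis ex_mset)
    have "length xs \<le> n" using size_le[OF p(1)] p(2) xs by simp
    moreover have "set xs \<subseteq> {..n}"
      using part_le[of _ p] p(2) xs by (fastforce simp del: sum_mset_sum_list)
    ultimately show "p \<in> mset ` {xs. set xs \<subseteq> {..n} \<and> length xs \<le> n}" using xs by blast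
  qed
  then show ?thesis
    by (rule finite_subset) (intro finite_imageI finite_lists_length_le finite_atMost)
qed

lemma finite_regular_bipartitions: "finite (regular_bipartitions s t n)"
  by (rule finite_subset[of _ "{p. is_partition p \<and> sum_mset p \<le> n} \<times> {p. is_partition p \<and> sum_mset p \<le> n}"])
     (auto simp: regular_bipartitions_def finite_partitions_le)

end

theory Submission
  imports Defs "HOL-Computational_Algebra.Formal_Power_Series"
begin

unbundle fps_syntax

text \<open>
  Modulo 17 we have \<open>f\<^sub>1\<^sub>7 = f\<^sub>1\<^sup>1\<^sup>7\<close>, so the generating function \<open>f\<^sub>2\<^sub>4\<^sub>3 f\<^sub>1\<^sub>7 / f\<^sub>1\<^sup>2\<close> becomes
  \<open>f\<^sub>2\<^sub>4\<^sub>3 f\<^sub>1\<^sup>1\<^sup>5\<close>. Since \<open>f\<^sub>2\<^sub>4\<^sub>3\<close> is a power series in \<open>q\<^sup>2\<^sup>4\<^sup>3\<close>, it does not interact with extracting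
  exponents modulo 81, and it suffices to study \<open>f\<^sub>1\<^sup>1\<^sup>5\<close>.
  By Jacobi's identity, \<open>f\<^sub>1\<^sup>3 = A(q\<^sup>3) - 3 q f\<^sub>9\<^sup>3\<close>; multiplying the three conjugates of this under
  \<open>q \<rightarrow> w q\<close>, \<open>w\<close> a cube root of unity, gives \<open>A\<^sup>3 f\<^sub>3\<^sup>3 = f\<^sub>1\<^sup>1\<^sup>2 + 27 q f\<^sub>3\<^sup>1\<^sup>2\<close>.
  Hence powers of \<open>f\<^sub>1\<^sup>3\<close> can be trisected explicitly: extracting from \<open>f\<^sub>1\<^sup>1\<^sup>5\<close> the exponents that are
  23 modulo 27 leaves \<open>17 * 9720 f\<^sub>1\<^sup>1\<^sup>2 f\<^sub>3\<^sup>3 + 2421009 q f\<^sub>3\<^sup>1\<^sup>5\<close>, which modulo 17 involves only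
  exponents that are 1 modulo 3. So the exponents 23 and 77 modulo 81 contribute nothing.
\<close>

section \<open>Jacobi's identity for the cube of the Euler product\<close>

definition fps_agree :: "nat \<Rightarrow> int fps \<Rightarrow> int fps \<Rightarrow> bool" where
  "fps_agree N F G \<longleftrightarrow> (\<forall>i<N. F $ i = G $ i)"

lemma fps_agree_refl [simp]: "fps_agree N F F"
  by (simp add: fps_agree_def)

lemma fps_agree_sym: "fps_agree N F G \<Longrightarrow> fps_agree N G F"
  by (simp add: fps_agree_def)

lemma fps_agree_trans [trans]: "fps_agree N F G \<Longrightarrow> fps_agree N G H \<Longrightarrow> fps_agree N F H"
  by (simp add: fps_agree_def)

lemma fps_agree_mono: "fps_agree N F G \<Longrightarrow> M \<le> N \<Longrightarrow> fps_agree M F G"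
  by (simp add: fps_agree_def)

lemma fps_agree_mult: "fps_agree N F G \<Longrightarrow> fps_agree N F' G' \<Longrightarrow> fps_agree N (F * F') (G * G')"
  by (auto simp: fps_agree_def fps_mult_nth intro!: sum.cong)

lemma fps_agree_power: "fps_agree N F G \<Longrightarrow> fps_agree N (F ^ k) (G ^ k)"
  by (induction k) (auto intro: fps_agree_mult)

lemma fps_agree_add: "fps_agree N F G \<Longrightarrow> fps_agree N F' G' \<Longrightarrow> fps_agree N (F + F') (G + G')"
  by (simp add: fps_agree_def)

lemma fps_agree_diff: "fps_agree N F G \<Longrightarrow> fps_agree N F' G' \<Longrightarrow> fps_agree N (F - F') (G - G')"
  by (simp add: fps_agree_def)

lemma fps_agree_sum:
  "(\<And>j. j \<in> A \<Longrightarrow> fps_agree N (F j) (G j)) \<Longrightarrow> fps_agree N (sum F A) (sum G A)"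
  by (simp add: fps_agree_def fps_sum_nth)

lemma fps_agree_shift:
  "fps_agree N F G \<Longrightarrow> fps_agree (k + N) (fps_X ^ k * F) (fps_X ^ k * G)"
  by (auto simp: fps_agree_def fps_X_power_mult_nth)

text \<open>Agreement to every order takes the place of a limit when finite products are replaced by
  infinite ones.\<close>

lemma fps_agree_imp_eq: "(\<And>N. fps_agree N F G) \<Longrightarrow> F = G"
  by (auto simp: fps_agree_def fps_eq_iff)

lemma int_fps_unit:
  fixes F :: "int fps"
  assumes "F $ 0 = 1"
  obtains G where "F * G = 1"
  using fps_right_inverse[of F 1] assms by auto

text \<open>A series with constant term 1 is a unit over the integers, so it also cancels from
  truncated identities.\<close>

lemma fps_agree_cancel:
  assumes "fps_agree N (H * F) (H * G)" "H $ 0 = 1"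
  shows "fps_agree N F G"
proof -
  obtain K where K: "H * K = 1" using int_fps_unit[OF assms(2)] .
  have "fps_agree N (K * (H * F)) (K * (H * G))"
    by (intro fps_agree_mult assms fps_agree_refl)
  moreover have "K * (H * F') = F'" for F'
    using K by (metis mult.assoc mult.commute mult_1)
  ultimately show ?thesis by simp
qed

section \<open>Finite Euler products and Gaussian binomials\<close>

definition qfact :: "nat \<Rightarrow> int fps" where
  "qfact n = (\<Prod>m=1..n. 1 - fps_X ^ m)"

lemma qfact_0 [simp]: "qfact 0 = 1"
  by (simp add: qfact_def)

lemma qfact_Suc: "qfact (Suc n) = qfact n * (1 - fps_X ^ Suc n)"
  by (simp add: qfact_def)

lemma qfact_nth_0 [simp]: "qfact n $ 0 = 1"
  by (induction n) (simp_all add: qfact_Suc del: power_Suc)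

lemma qfact_nonzero [simp]: "qfact n \<noteq> 0"
  by (rule fps_nonzeroI[of _ 0]) simp

lemma fps_agree_qfact: "m \<le> n \<Longrightarrow> fps_agree (Suc m) (qfact n) (qfact m)"
proof (induction n rule: dec_induct)
  case (step n)
  have "fps_agree (Suc m) (1 - fps_X ^ Suc n) 1"
    using step.hyps by (auto simp: fps_agree_def)
  then show ?case
    using fps_agree_mult[OF step.IH, of "1 - fps_X ^ Suc n" 1] by (simp add: qfact_Suc)
qed simp

text \<open>The infinite product f_1, with \<open>fps_X\<close> as q. Coefficient \<open>n\<close>
  of the finite products is stable from \<open>qfact n\<close> on, so the diagonal gives the
  limit.\<close>

definition euler :: "int fps" where
  "euler = Abs_fps (\<lambda>n. qfact n $ n)"

lemma fps_agree_euler: "fps_agree (Suc n) euler (qfact n)"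
proof -
  have "qfact n $ i = qfact i $ i" if "i < Suc n" for i
    using fps_agree_qfact[of i n] that by (simp add: fps_agree_def)
  then show ?thesis by (simp add: fps_agree_def euler_def)
qed

lemma euler_nth_0 [simp]: "euler $ 0 = 1"
  by (simp add: euler_def)

text \<open>The Gaussian binomials, given by a q-Pascal rule so that no division of series
  occurs.\<close>

fun gbinom :: "nat \<Rightarrow> nat \<Rightarrow> int fps" where
  "gbinom m 0 = 1"
| "gbinom 0 (Suc k) = 0"
| "gbinom (Suc m) (Suc k) = gbinom m k + fps_X ^ Suc k * gbinom m (Suc k)"

lemma gbinom_eq_0: "m < k \<Longrightarrow> gbinom m k = 0"
  by (induction m k rule: gbinom.induct) auto

lemma gbinom_self [simp]: "gbinom m m = 1"
  by (induction m) (simp_all add: gbinom_eq_0)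

text \<open>The usual quotient formula with denominators cleared. The Pascal rule reduces it to (1 -
  q^(a+1)) + q^(a+1) (1 - q^(b+1)) = 1 - q^(a+b+2).\<close>

lemma gbinom_qfact: "gbinom (k + l) k * (qfact k * qfact l) = qfact (k + l)"
proof (induction "k + l" arbitrary: k l)
  case (Suc s)
  show ?case
  proof (cases "k = 0 \<or> l = 0")
    case False
    then obtain a b where kl: "k = Suc a" "l = Suc b" by (metis not0_implies_Suc)
    have 1: "gbinom (a + l) a * (qfact a * qfact l) = qfact (a + l)"
      and 2: "gbinom (k + b) k * (qfact k * qfact b) = qfact (k + b)"
      by (rule Suc.hyps(1), use Suc.hyps(2) kl in simp)+
    have "gbinom (k + l) k * (qfact k * qfact l)
        = (gbinom (a + l) a * (qfact a * qfact l)) * (1 - fps_X ^ Suc a)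
          + fps_X ^ Suc a * (gbinom (k + b) k * (qfact k * qfact b)) * (1 - fps_X ^ Suc b)"
      by (simp add: kl qfact_Suc algebra_simps del: power_Suc)
    also have "\<dots> = qfact (Suc (a + b)) * (1 - fps_X ^ Suc (Suc (a + b)))"
      unfolding 1 2 by (simp add: kl algebra_simps power_add)
    also have "\<dots> = qfact (k + l)"
      by (simp add: kl qfact_Suc[of "Suc (a + b)"])
    finally show ?thesis .
  qed auto
qed simp

lemma gbinom_symmetric: "gbinom (k + l) l = gbinom (k + l) k"
proof -
  have "gbinom (k + l) l * (qfact k * qfact l) = gbinom (k + l) k * (qfact k * qfact l)"
    using gbinom_qfact[of k l] gbinom_qfact[of l k] by (simp add: ac_simps)
  then show ?thesis by simp
qed

text \<open>The second q-Pascal rule, the mirror image of the defining one under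
  \<open>gbinom_symmetric\<close>.\<close>

lemma gbinom_Suc_Suc':
  "gbinom (Suc (k + l)) (Suc k) = gbinom (k + l) (Suc k) + fps_X ^ l * gbinom (k + l) k"
proof (cases l)
  case (Suc b)
  have "gbinom (Suc (k + l)) (Suc k) = gbinom (Suc k + l) l"
    using gbinom_symmetric[of "Suc k" l] by simp
  also have "\<dots> = gbinom (k + l) b + fps_X ^ l * gbinom (k + l) l"
    by (simp add: Suc)
  also have "gbinom (k + l) l = gbinom (k + l) k"
    by (rule gbinom_symmetric)
  also have "gbinom (k + l) b = gbinom (k + l) (Suc k)"
    using gbinom_symmetric[of "Suc k" b] by (simp add: Suc)
  finally show ?thesis .
qed (simp add: gbinom_eq_0)

section \<open>Jacobi's identity in finite and infinite form\<close>

definition central_gbinom :: "nat \<Rightarrow> nat \<Rightarrow> int fps" where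
  "central_gbinom n j = (if j \<le> n then gbinom (2 * n + 1) (n - j) else 0)"

text \<open>Two Pascal steps, the mirrored rule and then the defining one, lower the top from 2n+3
  to 2n+1 and reach the neighbours j-1, j, j+1. At j = 0 the symmetry folds the index -1 back to
  0.\<close>

lemma central_gbinom_Suc:
  "central_gbinom (Suc n) j = (1 + fps_X ^ (2 * n + 2)) * central_gbinom n j
     + (if j \<le> Suc n then fps_X ^ (n + 1 - j) * (if j = 0 then central_gbinom n 0 else central_gbinom n (j - 1)) else 0)
     + fps_X ^ (n + 2 + j) * central_gbinom n (Suc j)"
proof -
  consider "j > Suc n" | "j = Suc n" | "j \<le> n"
    by linarith
  then show ?thesis
  proof cases
    case 1
    then show ?thesis by (simp add: central_gbinom_def)
  next
    case 2
    show ?thesis unfolding 2 by (simp add: central_gbinom_def)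
  next
    case 3
    then obtain k where n: "n = j + k"
      using le_Suc_ex by blast
    have 1: "gbinom (2 * n + 3) (Suc k)
        = gbinom (2 * n + 2) (Suc k) + fps_X ^ (n + 2 + j) * gbinom (2 * n + 2) k"
      using gbinom_Suc_Suc'[of k "n + 2 + j"] n by (simp add: eval_nat_numeral ac_simps)
    have 2: "gbinom (2 * n + 2) (Suc k)
        = gbinom (2 * n + 1) k + fps_X ^ Suc k * gbinom (2 * n + 1) (Suc k)"
      by simp
    have 6: "fps_X ^ (n + 2 + j) * gbinom (2 * n + 2) k
        = fps_X ^ (n + 2 + j) * central_gbinom n (Suc j) + fps_X ^ (2 * n + 2) * gbinom (2 * n + 1) k"
    proof (cases k)
      case (Suc b)
      have "fps_X ^ (n + 2 + j) * (fps_X ^ k :: int fps) = fps_X ^ (2 * n + 2)"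
        using n by (simp flip: power_add)
      moreover have "central_gbinom n (Suc j) = gbinom (2 * n + 1) b"
        using n Suc by (simp add: central_gbinom_def)
      moreover have "gbinom (2 * n + 2) k = gbinom (2 * n + 1) b + fps_X ^ k * gbinom (2 * n + 1) k"
        by (simp add: Suc)
      ultimately show ?thesis
        by (simp only: distrib_left mult.assoc[symmetric])
    qed (use n in \<open>simp add: central_gbinom_def\<close>)
    have diff: "n - j = k" "Suc n - j = Suc k" "n + 1 - j = Suc k" "j \<le> Suc n"
      using n by auto
    have 4: "gbinom (2 * n + 1) (Suc k) = (if j = 0 then central_gbinom n 0 else central_gbinom n (j - 1))"
    proof (cases j)
      case 0
      then show ?thesis
        using n gbinom_symmetric[of n "Suc n"] by (simp add: central_gbinom_def mult_2)
    next
      case (Suc i)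
      then have "n - i = Suc k" "i \<le> n" using n by auto
      then show ?thesis by (simp add: Suc central_gbinom_def)
    qed
    have "central_gbinom n j = gbinom (2 * n + 1) k"
      using 3 by (simp add: central_gbinom_def diff)
    moreover have "central_gbinom (Suc n) j = gbinom (2 * n + 3) (Suc k)"
      using 3 by (simp add: central_gbinom_def diff numeral_3_eq_3 del: gbinom.simps)
    ultimately show ?thesis
      unfolding 1 2 6 4 by (simp add: algebra_simps diff del: gbinom.simps)
  qed
qed

definition tri :: "nat \<Rightarrow> nat" where
  "tri j = j * (j + 1) div 2"

lemma tri_0 [simp]: "tri 0 = 0" and tri_Suc: "tri (Suc j) = tri j + Suc j"
  by (simp_all add: tri_def)

definition jacobi_term :: "nat \<Rightarrow> int fps" where
  "jacobi_term j = fps_const ((-1) ^ j * (2 * int j + 1)) * fps_X ^ tri j"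

text \<open>When \<open>central_gbinom_Suc\<close> is inserted into the sum of \<open>finite_jacobi\<close>, the left-hand side
  below is the total coefficient of \<open>central_gbinom n j\<close>.\<close>

lemma jacobi_term_shift:
  assumes "j \<le> n"
  shows "(1 + fps_X ^ (2 * n + 2)) * jacobi_term j + jacobi_term (Suc j) * fps_X ^ (n - j)
     - fps_const ((-1) ^ j * (2 * int j - 1)) * fps_X ^ tri j * fps_X ^ (n + 1)
     = (1 - fps_X ^ Suc n)\<^sup>2 * jacobi_term j"
proof -
  have "(fps_X ^ tri (Suc j) :: int fps) * fps_X ^ (n - j) = fps_X ^ tri j * fps_X ^ (n + 1)"
    using assms by (simp add: tri_Suc flip: power_add)
  moreover have "fps_const ((-1) ^ Suc j * (2 * int (Suc j) + 1))
      = - fps_const ((-1) ^ j * (2 * int j + 3))"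
    by (simp add: algebra_simps)
  ultimately have *: "jacobi_term (Suc j) * fps_X ^ (n - j)
      = - fps_const ((-1) ^ j * (2 * int j + 3)) * fps_X ^ tri j * fps_X ^ (n + 1)"
    unfolding jacobi_term_def by (simp only: mult.assoc)
  \<comment> \<open>The coefficients 2j+3 and 2j-1 lie symmetrically around 2j+1, so together they
    give the middle term of the square (1 - q^(n+1))^2.\<close>
  have **: "fps_const ((-1) ^ j * (2 * int j + 3)) = fps_const ((-1) ^ j * (2 * int j + 1)) + 2 * fps_const ((-1) ^ j)"
       "fps_const ((-1) ^ j * (2 * int j - 1)) = fps_const ((-1) ^ j * (2 * int j + 1)) - 2 * fps_const ((-1) ^ j)"
    by (simp_all add: numeral_fps_const algebra_simps)
  have ***: "(fps_X :: int fps) ^ (2 * n + 2) = (fps_X ^ Suc n)\<^sup>2"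
    by (simp add: power_mult[symmetric] del: power_Suc)
  define c where "c = fps_const ((-1) ^ j * (2 * int j + 1))"
  show ?thesis
    unfolding * unfolding ** *** jacobi_term_def c_def[symmetric] by (simp add: algebra_simps power2_eq_square)
qed

text \<open>A finite form of Jacobi's identity: for \<open>n\<close> tending to infinity, every \<open>central_gbinom n j\<close>
  tends to \<open>1 / euler\<close>.\<close>

lemma finite_jacobi: "(\<Sum>j\<le>n. jacobi_term j * central_gbinom n j) = (qfact n)\<^sup>2"
proof (induction n)
  case 0
  show ?case by (simp add: jacobi_term_def central_gbinom_def)
next
  case (Suc n)
  \<comment> \<open>\<open>v j\<close> is the coefficient of \<open>central_gbinom n j\<close>
    coming from its left neighbour. The closed formula does not vanish at j = 0: there it is the
    folded term of the second sum, which completes the shifted third sum.\<close>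
  define v :: "nat \<Rightarrow> int fps" where
    "v j = - (fps_const ((-1) ^ j * (2 * int j - 1)) * fps_X ^ tri j * fps_X ^ (n + 1))" for j
  have v0: "v 0 = fps_X ^ (n + 1)"
    by (simp add: v_def del: fps_const_neg flip: fps_const_neg)
  have vS: "v (Suc j) = jacobi_term j * fps_X ^ (n + 2 + j)" for j
  proof -
    have "- fps_const ((-1) ^ Suc j * (2 * int (Suc j) - 1)) = fps_const ((-1) ^ j * (2 * int j + 1))"
      by (simp add: algebra_simps)
    moreover have "(fps_X :: int fps) ^ tri (Suc j) * fps_X ^ (n + 1) = fps_X ^ tri j * fps_X ^ (n + 2 + j)"
      by (simp add: tri_Suc flip: power_add)
    ultimately show ?thesis
      unfolding v_def jacobi_term_def by (simp only: mult.assoc minus_mult_left)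
  qed
  have z: "central_gbinom n (Suc n) = 0" "central_gbinom n (Suc (Suc n)) = 0"
    by (simp_all add: central_gbinom_def)
  have "(\<Sum>j\<le>Suc n. jacobi_term j * central_gbinom (Suc n) j)
     = (\<Sum>j\<le>Suc n. (1 + fps_X ^ (2 * n + 2)) * jacobi_term j * central_gbinom n j)
     + (\<Sum>j\<le>Suc n. jacobi_term j * (fps_X ^ (n + 1 - j) * (if j = 0 then central_gbinom n 0 else central_gbinom n (j - 1))))
     + (\<Sum>j\<le>Suc n. v (Suc j) * central_gbinom n (Suc j))"
    unfolding sum.distrib[symmetric]
    by (intro sum.cong refl) (simp add: central_gbinom_Suc[of n] vS algebra_simps)
  also have "(\<Sum>j\<le>Suc n. (1 + fps_X ^ (2 * n + 2)) * jacobi_term j * central_gbinom n j)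
      = (\<Sum>j\<le>n. (1 + fps_X ^ (2 * n + 2)) * jacobi_term j * central_gbinom n j)"
    by (simp add: z)
  also have "(\<Sum>j\<le>Suc n. jacobi_term j * (fps_X ^ (n + 1 - j) * (if j = 0 then central_gbinom n 0 else central_gbinom n (j - 1))))
      = v 0 * central_gbinom n 0 + (\<Sum>j\<le>n. jacobi_term (Suc j) * fps_X ^ (n - j) * central_gbinom n j)"
    by (subst sum.atMost_Suc_shift) (simp add: v0 jacobi_term_def mult.assoc)
  also have "(\<Sum>j\<le>Suc n. v (Suc j) * central_gbinom n (Suc j)) = (\<Sum>j\<le>n. v j * central_gbinom n j) - v 0 * central_gbinom n 0"
  proof -
    have "(\<Sum>j\<le>Suc (Suc n). v j * central_gbinom n j) = v 0 * central_gbinom n 0 + (\<Sum>j\<le>Suc n. v (Suc j) * central_gbinom n (Suc j))"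
      by (rule sum.atMost_Suc_shift)
    then show ?thesis by (simp add: z)
  qed
  finally have "(\<Sum>j\<le>Suc n. jacobi_term j * central_gbinom (Suc n) j)
     = (\<Sum>j\<le>n. ((1 + fps_X ^ (2 * n + 2)) * jacobi_term j + jacobi_term (Suc j) * fps_X ^ (n - j) + v j) * central_gbinom n j)"
    by (simp add: sum.distrib algebra_simps)
  also have "\<dots> = (\<Sum>j\<le>n. (1 - fps_X ^ Suc n)\<^sup>2 * (jacobi_term j * central_gbinom n j))"
    by (intro sum.cong refl, subst mult.assoc[symmetric], subst jacobi_term_shift[symmetric])
       (simp_all add: v_def)
  also have "\<dots> = (qfact (Suc n))\<^sup>2"
    by (simp add: sum_distrib_left[symmetric] Suc.IH qfact_Suc power_mult_distrib)
  finally show ?case .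
qed

text \<open>By \<open>gbinom_qfact\<close> the binomial is a quotient of finite products, each of
  which agrees with \<open>euler\<close> to the order stated. One factor \<open>euler\<close> is
  added for this and cancelled at the end.\<close>

lemma euler_mult_central_gbinom:
  assumes "j \<le> n"
  shows "fps_agree (Suc (n - j)) (euler * central_gbinom n j) 1"
proof -
  let ?m = "n - j" and ?l = "n + 1 + j"
  have e: "fps_agree (Suc ?m) euler (qfact k)" if "?m \<le> k" for k
    using fps_agree_euler[of k] that by (auto intro: fps_agree_mono)
  have *: "central_gbinom n j * (qfact ?m * qfact ?l) = qfact (2 * n + 1)"
    using gbinom_qfact[of ?m ?l] assms by (simp add: central_gbinom_def mult_2)
  have "fps_agree (Suc ?m) (euler * (euler * central_gbinom n j)) (qfact ?m * (qfact ?l * central_gbinom n j))"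
    by (intro fps_agree_mult e fps_agree_refl) auto
  also have "qfact ?m * (qfact ?l * central_gbinom n j) = qfact (2 * n + 1)"
    using * by (simp add: ac_simps)
  also have "fps_agree (Suc ?m) \<dots> euler"
    by (intro fps_agree_sym[OF e]) auto
  finally show ?thesis
    using fps_agree_cancel[of _ euler "euler * central_gbinom n j" 1] by simp
qed

lemma jacobi_euler_cube: "fps_agree (Suc n) (euler ^ 3) (\<Sum>j\<le>n. jacobi_term j)"
proof -
  have le: "j \<le> tri j" for j by (induction j) (auto simp: tri_Suc)
  have "fps_agree (Suc n) (euler ^ 3) (euler * (qfact n)\<^sup>2)"
    using fps_agree_euler[of n]
    by (auto simp: power3_eq_cube power2_eq_square mult.assoc intro!: fps_agree_mult)
  also have "euler * (qfact n)\<^sup>2 = (\<Sum>j\<le>n. fps_const ((-1) ^ j * (2 * int j + 1)) * (fps_X ^ tri j * (euler * central_gbinom n j)))"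
    by (simp add: finite_jacobi[symmetric] sum_distrib_left jacobi_term_def ac_simps)
  also have "fps_agree (Suc n) \<dots> (\<Sum>j\<le>n. fps_const ((-1) ^ j * (2 * int j + 1)) * (fps_X ^ tri j * 1))"
  proof (rule fps_agree_sum, rule fps_agree_mult[OF fps_agree_refl])
    fix j assume "j \<in> {..n}"
    then have "fps_agree (tri j + Suc (n - j)) (fps_X ^ tri j * (euler * central_gbinom n j)) (fps_X ^ tri j * 1)"
      by (intro fps_agree_shift euler_mult_central_gbinom) auto
    then show "fps_agree (Suc n) (fps_X ^ tri j * (euler * central_gbinom n j)) (fps_X ^ tri j * 1)"
      \<comment> \<open>The error starts at exponent tri j + (n - j) + 1, which is at least n + 1
        because \<open>j \<le> tri j\<close>.\<close>
      by (rule fps_agree_mono) (use le[of j] in auto)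
  qed
  finally show ?thesis by (simp add: jacobi_term_def)
qed


section \<open>Trisection of power series\<close>

lemma nth_dilate:
  fixes F :: "int fps"
  assumes "k > 0"
  shows "(F oo fps_X ^ k) $ n = (if k dvd n then F $ (n div k) else 0)"
proof -
  have "(F oo fps_X ^ k) $ n = (\<Sum>i\<in>{0..n}. F $ i * (if n = k * i then 1 else 0))"
    by (simp add: fps_compose_nth power_mult[symmetric])
  also have "\<dots> = (\<Sum>i\<in>{0..n}. if i = n div k \<and> k dvd n then F $ i else 0)"
    using assms by (intro sum.cong) auto
  also have "\<dots> = (if k dvd n then F $ (n div k) else 0)"
    by (cases "k dvd n") (simp_all add: sum.delta)
  finally show ?thesis .
qed

lemma dilate_mult:
  fixes F G :: "int fps"
  shows "k > 0 \<Longrightarrow> (F * G) oo fps_X ^ k = (F oo fps_X ^ k) * (G oo fps_X ^ k)"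
  by (rule fps_compose_mult_distrib) simp

lemma dilate_power:
  fixes F :: "int fps"
  shows "k > 0 \<Longrightarrow> F ^ n oo fps_X ^ k = (F oo fps_X ^ k) ^ n"
  by (induction n) (simp_all add: dilate_mult)

lemma dilate_X_power:
  "k > 0 \<Longrightarrow> (fps_X ^ n :: int fps) oo fps_X ^ k = fps_X ^ (k * n)"
  by (simp add: dilate_power power_mult)

lemma dilate_dilate:
  fixes F :: "int fps"
  assumes "k > 0" "l > 0"
  shows "(F oo fps_X ^ k) oo fps_X ^ l = F oo fps_X ^ (k * l)"
proof (rule fps_ext)
  fix n
  have "l dvd n \<and> k dvd n div l \<longleftrightarrow> k * l dvd n"
    using assms by (metis dvd_div_iff_mult dvd_mult_right less_numeral_extra(3))
  then show "((F oo fps_X ^ k) oo fps_X ^ l) $ n = (F oo fps_X ^ (k * l)) $ n"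
    using assms by (auto simp: nth_dilate div_mult2_eq mult.commute)
qed

lemma fps_agree_dilate:
  assumes "fps_agree N F G" "k > 0"
  shows "fps_agree (k * N) (F oo fps_X ^ k) (G oo fps_X ^ k)"
  using assms by (auto simp: fps_agree_def nth_dilate elim!: dvdE)

definition trisect :: "nat \<Rightarrow> int fps \<Rightarrow> int fps" where
  "trisect r F = Abs_fps (\<lambda>n. F $ (3 * n + r))"

lemma trisect_nth [simp]: "trisect r F $ n = F $ (3 * n + r)"
  by (simp add: trisect_def)

lemma trisect_add: "trisect r (F + G) = trisect r F + trisect r G"
  and trisect_diff: "trisect r (F - G) = trisect r F - trisect r G"
  by (simp_all add: fps_eq_iff)

lemma trisect_numeral_mult: "trisect r (numeral c * F) = numeral c * trisect r F"
  by (simp add: fps_eq_iff numeral_fps_const)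

text \<open>Multiplication by q permutes the residue classes cyclically; wrapping from 2 to 0 costs
  a factor q.\<close>

lemma trisect_X_mult:
  "trisect 0 (fps_X * F) = fps_X * trisect 2 F"
  "trisect 1 (fps_X * F) = trisect 0 F"
  "trisect 2 (fps_X * F) = trisect 1 F"
proof -
  have "(fps_X * F) $ (3 * n + 0) = (fps_X * trisect 2 F) $ n" for n
    by (cases n) simp_all
  then show "trisect 0 (fps_X * F) = fps_X * trisect 2 F"
    by (simp add: fps_eq_iff)
qed (simp_all add: fps_eq_iff)

lemma trisect_dilate:
  "trisect 0 (F oo fps_X ^ 3) = F"
  "trisect 1 (F oo fps_X ^ 3) = 0"
  "trisect (Suc 0) (F oo fps_X ^ 3) = 0"
  "trisect 2 (F oo fps_X ^ 3) = 0"
proof -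
  have "\<not> 3 dvd 3 * n + 1" "\<not> 3 dvd 3 * n + 2" for n :: nat by presburger+
  then show "trisect 1 (F oo fps_X ^ 3) = 0" "trisect (Suc 0) (F oo fps_X ^ 3) = 0"
    "trisect 2 (F oo fps_X ^ 3) = 0"
    by (simp_all add: fps_eq_iff nth_dilate)
qed (simp add: fps_eq_iff nth_dilate)

lemma trisect_decomp:
  "F = (trisect 0 F oo fps_X ^ 3) + fps_X * (trisect 1 F oo fps_X ^ 3)
     + fps_X * (fps_X * (trisect 2 F oo fps_X ^ 3))"
proof (rule fps_ext)
  fix n :: nat
  have "n = 3 * (n div 3) + n mod 3" "n mod 3 < 3" by simp_all
  then obtain m r where "n = 3 * m + r" "r < 3" by blast
  then consider "n = 3 * m" | "n = 3 * m + 1" | "n = 3 * m + 2" by linarith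
  then show "F $ n = ((trisect 0 F oo fps_X ^ 3) + fps_X * (trisect 1 F oo fps_X ^ 3)
     + fps_X * (fps_X * (trisect 2 F oo fps_X ^ 3))) $ n"
  proof cases
    case 1
    have "\<not> 3 dvd 3 * m - 1 \<or> m = 0" "\<not> 3 dvd 3 * m - 1 - 1 \<or> m = 0" by presburger+
    then show ?thesis using 1 by (auto simp: nth_dilate)
  next
    case 2
    have "\<not> 3 dvd 3 * m + 1" "\<not> 3 dvd 3 * m - 1 \<or> m = 0" by presburger+
    then show ?thesis using 2 by (auto simp: nth_dilate)
  next
    case 3
    have "\<not> 3 dvd 3 * m + 1" "\<not> 3 dvd 3 * m + 2" by presburger+
    then show ?thesis using 3 by (auto simp: nth_dilate)
  qed
qed

text \<open>Two decompositions a(q^3) + q b(q^3) + q^2 c(q^3) are multiplied out; the products in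
  q^3 and q^4 carry over a factor q^3, which becomes q in the components.\<close>

lemma trisect_mult:
  "trisect 0 (F * G) = trisect 0 F * trisect 0 G
     + fps_X * (trisect 1 F * trisect 2 G + trisect 2 F * trisect 1 G)"
  "trisect 1 (F * G) = trisect 0 F * trisect 1 G + trisect 1 F * trisect 0 G
     + fps_X * (trisect 2 F * trisect 2 G)"
  "trisect 2 (F * G) = trisect 0 F * trisect 2 G + trisect 1 F * trisect 1 G
     + trisect 2 F * trisect 0 G"
proof -
  define a b c where "a = trisect 0 F" and "b = trisect 1 F" and "c = trisect 2 F"
  define a' b' c' where "a' = trisect 0 G" and "b' = trisect 1 G" and "c' = trisect 2 G"
  note defs = a_def b_def c_def a'_def b'_def c'_def
  let ?d = "\<lambda>H :: int fps. H oo fps_X ^ 3"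
  have X3: "?d fps_X = fps_X * (fps_X * fps_X)"
    by (simp add: power3_eq_cube mult.assoc)
  have F: "F = ?d a + fps_X * ?d b + fps_X * (fps_X * ?d c)"
    and G: "G = ?d a' + fps_X * ?d b' + fps_X * (fps_X * ?d c')"
    unfolding defs by (rule trisect_decomp)+
  have *: "F * G = ?d (a * a' + fps_X * (b * c' + c * b'))
      + fps_X * ?d (a * b' + b * a' + fps_X * (c * c'))
      + fps_X * (fps_X * ?d (a * c' + b * b' + c * a'))"
    by (subst F, subst G) (simp add: dilate_mult fps_compose_add_distrib X3 algebra_simps)
  show "trisect 0 (F * G) = trisect 0 F * trisect 0 G
      + fps_X * (trisect 1 F * trisect 2 G + trisect 2 F * trisect 1 G)"
    "trisect 1 (F * G) = trisect 0 F * trisect 1 G + trisect 1 F * trisect 0 G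
      + fps_X * (trisect 2 F * trisect 2 G)"
    "trisect 2 (F * G) = trisect 0 F * trisect 2 G + trisect 1 F * trisect 1 G
      + trisect 2 F * trisect 0 G"
    unfolding * unfolding defs[symmetric]
    by (simp_all only: trisect_add trisect_X_mult trisect_dilate add_0 add_0_right mult_zero_right)
qed

text \<open>A series in q^3 behaves like a scalar under trisection; this is what pulls out powers of
  f_3 and the factor f_243.\<close>

lemma trisect_mult_dilate:
  assumes "r < 3"
  shows "trisect r (F * (G oo fps_X ^ 3)) = trisect r F * G"
proof -
  consider "r = 0" | "r = 1" | "r = 2" using assms by linarith
  then show ?thesis
    by cases (simp_all only: trisect_mult trisect_dilate, simp_all)
qed

section \<open>The cubic norm and its value on Euler's product\<close>

text \<open>With \<open>w\<close> a primitive cube root of unity, \<open>F(q) F(w q) F(w\<^sup>2 q)\<close> is \<open>cubic_norm F\<close> evaluated at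
  \<open>q\<^sup>3\<close>; the explicit formula stays over the integers.\<close>

definition cubic_norm :: "int fps \<Rightarrow> int fps" where
  "cubic_norm F = trisect 0 F ^ 3 + fps_X * trisect 1 F ^ 3 + fps_X\<^sup>2 * trisect 2 F ^ 3
     - 3 * fps_X * trisect 0 F * trisect 1 F * trisect 2 F"

text \<open>This is the norm form for adjoining a cube root of q; on components, multiplicativity is
  a polynomial identity.\<close>

lemma cubic_norm_mult: "cubic_norm (F * G) = cubic_norm F * cubic_norm G"
  unfolding cubic_norm_def trisect_mult by algebra

lemma trisect_one: "trisect 0 1 = 1" "trisect (Suc 0) 1 = 0" "trisect 2 1 = 0"
  by (auto simp: fps_eq_iff)

lemma cubic_norm_1: "cubic_norm 1 = 1"
  by (simp add: cubic_norm_def trisect_one)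

lemma cubic_norm_power: "cubic_norm (F ^ n) = cubic_norm F ^ n"
  by (induction n) (simp_all add: cubic_norm_1 cubic_norm_mult)

lemma fps_agree_cubic_norm:
  assumes "fps_agree (3 * N) F G"
  shows "fps_agree N (cubic_norm F) (cubic_norm G)"
proof -
  have "fps_agree N (trisect r F) (trisect r G)" if "r < 3" for r
    using assms that by (auto simp: fps_agree_def)
  then show ?thesis
    unfolding cubic_norm_def
    by (intro fps_agree_diff fps_agree_add fps_agree_mult fps_agree_power fps_agree_refl) auto
qed

text \<open>The conjugates of 1 - q^e coincide if 3 divides e. Otherwise (1 - x) (1 - w x) (1 - w^2
  x) = 1 - x^3 applies, and q^3 is then read as q.\<close>

lemma cubic_norm_one_minus:
  "cubic_norm (1 - fps_X ^ (3 * m)) = (1 - fps_X ^ m) ^ 3"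
  "cubic_norm (1 - fps_X ^ (3 * m + 1)) = 1 - fps_X ^ (3 * m + 1)"
  "cubic_norm (1 - fps_X ^ (3 * m + 2)) = 1 - fps_X ^ (3 * m + 2)"
proof -
  have d: "fps_X ^ (3 * m) = (fps_X ^ m oo fps_X ^ 3 :: int fps)"
    by (simp add: dilate_X_power)
  have t: "trisect 0 (fps_X ^ (3 * m)) = fps_X ^ m" "trisect 1 (fps_X ^ (3 * m)) = 0"
     "trisect 2 (fps_X ^ (3 * m)) = 0"
    unfolding d by (simp_all add: trisect_dilate)
  show "cubic_norm (1 - fps_X ^ (3 * m)) = (1 - fps_X ^ m) ^ 3"
    using t by (simp add: cubic_norm_def trisect_diff trisect_one)
  have p1: "fps_X ^ (3 * m + 1) = fps_X * (fps_X ^ (3 * m) :: int fps)"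
    and p2: "fps_X ^ (3 * m + 2) = fps_X * (fps_X * (fps_X ^ (3 * m) :: int fps))"
    by simp_all
  have p3: "(fps_X ^ m) ^ 3 = (fps_X ^ (3 * m) :: int fps)"
    by (simp add: mult.commute flip: power_mult)
  show "cubic_norm (1 - fps_X ^ (3 * m + 1)) = 1 - fps_X ^ (3 * m + 1)"
    unfolding cubic_norm_def p1 trisect_diff trisect_X_mult t
    by (simp add: trisect_one p3)
  show "cubic_norm (1 - fps_X ^ (3 * m + 2)) = 1 - fps_X ^ (3 * m + 2)"
    unfolding cubic_norm_def p2 trisect_diff trisect_X_mult t
    by (simp add: trisect_one p3 power2_eq_square mult.assoc)
qed

text \<open>The norm cubes the factors whose index is a multiple of 3 and lowers that index to a
  third, giving \<open>qfact m ^ 3\<close>; it keeps the others. The dilated \<open>qfact m\<close>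
  supplies the factors missing from \<open>qfact (3 * m)\<close>.\<close>

lemma cubic_norm_qfact:
  "cubic_norm (qfact (3 * m)) * (qfact m oo fps_X ^ 3) = qfact m ^ 3 * qfact (3 * m)"
proof (induction m)
  case (Suc m)
  have 1: "qfact (3 * Suc m) = qfact (3 * m) * (1 - fps_X ^ (3 * m + 1)) * (1 - fps_X ^ (3 * m + 2))
      * (1 - fps_X ^ (3 * Suc m))"
    by (simp add: qfact_Suc numeral_2_eq_2 numeral_3_eq_3 del: power_Suc)
  have 2: "qfact (Suc m) oo fps_X ^ 3 = (qfact m oo fps_X ^ 3) * (1 - fps_X ^ (3 * Suc m))"
    by (simp add: qfact_Suc dilate_mult fps_compose_sub_distrib dilate_X_power del: power_Suc)
  have "cubic_norm (qfact (3 * Suc m)) * (qfact (Suc m) oo fps_X ^ 3)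
     = (cubic_norm (qfact (3 * m)) * (qfact m oo fps_X ^ 3)) * (1 - fps_X ^ Suc m) ^ 3
       * (1 - fps_X ^ (3 * m + 1)) * (1 - fps_X ^ (3 * m + 2)) * (1 - fps_X ^ (3 * Suc m))"
    unfolding 1 2 cubic_norm_mult cubic_norm_one_minus by (simp only: ac_simps)
  also have "\<dots> = qfact (Suc m) ^ 3 * qfact (3 * Suc m)"
    unfolding Suc.IH 1 by (simp only: qfact_Suc power_mult_distrib ac_simps)
  finally show ?case .
qed (simp add: cubic_norm_1)

text \<open>The limit of the finite version: the norm of f_1 is f_1^4 / f_3.\<close>

lemma cubic_norm_euler: "cubic_norm euler * (euler oo fps_X ^ 3) = euler ^ 4"
proof (rule fps_agree_imp_eq)
  fix N
  have e: "fps_agree N euler (qfact n)" if "N \<le> n" for n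
    using fps_agree_euler[of n] that by (auto intro: fps_agree_mono)
  have "fps_agree N (cubic_norm euler * (euler oo fps_X ^ 3)) (cubic_norm (qfact (3 * N)) * (qfact N oo fps_X ^ 3))"
  proof (rule fps_agree_mult)
    show "fps_agree N (cubic_norm euler) (cubic_norm (qfact (3 * N)))"
      by (rule fps_agree_cubic_norm, rule fps_agree_mono[OF fps_agree_euler]) simp
    have "fps_agree (3 * N) (euler oo fps_X ^ 3) (qfact N oo fps_X ^ 3)"
      by (intro fps_agree_dilate e) auto
    then show "fps_agree N (euler oo fps_X ^ 3) (qfact N oo fps_X ^ 3)"
      by (rule fps_agree_mono) simp
  qed
  also have "\<dots> = qfact N ^ 3 * qfact (3 * N)"
    by (rule cubic_norm_qfact)
  also have "fps_agree N \<dots> (euler ^ 3 * euler)"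
    by (intro fps_agree_sym[OF fps_agree_mult] fps_agree_power e) auto
  also have "euler ^ 3 * euler = euler ^ 4"
    by (simp add: eval_nat_numeral)
  finally show "fps_agree N (cubic_norm euler * (euler oo fps_X ^ 3)) (euler ^ 4)" .
qed

section \<open>Trisection of powers of Euler's product\<close>

lemma tri_add3: "tri (3 * m + r) mod 3 = tri r mod 3"
proof (induction m)
  case (Suc m)
  have "tri (3 * Suc m + r) = tri (3 * m + r) + 3 * (3 * m + r + 2)"
    by (simp add: tri_Suc eval_nat_numeral)
  then show ?case using Suc.IH by presburger
qed simp

lemma tri_3_plus_1: "tri (3 * m + 1) = 9 * tri m + 1"
proof (induction m)
  case (Suc m)
  have "tri (3 * Suc m + 1) = tri (3 * m + 1) + 9 * Suc m"
    by (simp add: tri_Suc eval_nat_numeral)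
  then show ?case using Suc.IH by (simp add: tri_Suc)
qed (simp add: tri_def)

lemma sum_atMost_mult_3:
  fixes h :: "nat \<Rightarrow> int"
  shows "(\<Sum>j\<le>3 * n + 2. h j) = (\<Sum>m\<le>n. h (3 * m) + h (3 * m + 1) + h (3 * m + 2))"
  by (induction n) (simp_all add: eval_nat_numeral)

lemma euler_cube_nth:
  "i \<le> n \<Longrightarrow> euler ^ 3 $ i = (\<Sum>j\<le>n. if i = tri j then (-1) ^ j * (2 * int j + 1) else 0)"
proof -
  assume "i \<le> n"
  then have "euler ^ 3 $ i = (\<Sum>j\<le>n. jacobi_term j $ i)"
    using jacobi_euler_cube[of n] by (simp add: fps_agree_def fps_sum_nth)
  also have "\<dots> = (\<Sum>j\<le>n. if i = tri j then (-1) ^ j * (2 * int j + 1) else 0)"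
    by (intro sum.cong refl) (simp add: jacobi_term_def)
  finally show ?thesis .
qed

text \<open>A triangular number is never 2 modulo 3, and \<open>tri j\<close> is 1 modulo 3 exactly
  for j = 3m+1. There it equals 9 tri m + 1, with coefficient -3 times that of \<open>m\<close>, so
  Jacobi's series reappears.\<close>

lemma trisect_euler_cube:
  "trisect 1 (euler ^ 3) = - 3 * (euler ^ 3 oo fps_X ^ 3)"
  "trisect 2 (euler ^ 3) = 0"
proof -
  have t: "tri (3 * m) mod 3 = 0" "tri (3 * m + 1) mod 3 = 1" "tri (3 * m + 2) mod 3 = 0" for m
    using tri_add3[of m 0] tri_add3[of m 1] tri_add3[of m 2]
    by (simp_all add: tri_def)
  show "trisect 1 (euler ^ 3) = - 3 * (euler ^ 3 oo fps_X ^ 3)"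
  proof (rule fps_ext)
    fix k
    define c :: "nat \<Rightarrow> int" where "c j = (-1) ^ j * (2 * int j + 1)" for j
    \<comment> \<open>The bound exceeds the exponent by one so that the indices form complete
      triples.\<close>
    have "trisect 1 (euler ^ 3) $ k = (\<Sum>j\<le>3 * k + 2. if 3 * k + 1 = tri j then c j else 0)"
      unfolding trisect_nth c_def by (rule euler_cube_nth) simp
    also have "\<dots> = (\<Sum>m\<le>k. if 3 * k + 1 = tri (3 * m + 1) then c (3 * m + 1) else 0)"
    proof -
      have "3 * k + 1 \<noteq> tri (3 * m)" "3 * k + 1 \<noteq> tri (3 * m + 2)" for m
        using t[of m] by presburger+
      then show ?thesis unfolding sum_atMost_mult_3 by (intro sum.cong) simp_all
    qed
    also have "\<dots> = (\<Sum>m\<le>k. - 3 * (if 3 dvd k \<and> k div 3 = tri m then c m else 0))"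
    proof (rule sum.cong[OF refl])
      fix m
      have "c (3 * m + 1) = - 3 * c m"
        by (simp add: c_def power_mult)
      then show "(if 3 * k + 1 = tri (3 * m + 1) then c (3 * m + 1) else 0)
          = - 3 * (if 3 dvd k \<and> k div 3 = tri m then c m else 0)"
        unfolding tri_3_plus_1 by auto
    qed
    also have "\<dots> = - 3 * (if 3 dvd k then euler ^ 3 $ (k div 3) else 0)"
      unfolding sum_distrib_left[symmetric] c_def
      using euler_cube_nth[of "k div 3" k] by simp
    also have "\<dots> = (- 3 * (euler ^ 3 oo fps_X ^ 3)) $ k"
      by (simp add: nth_dilate numeral_fps_const)
    finally show "trisect 1 (euler ^ 3) $ k = (- 3 * (euler ^ 3 oo fps_X ^ 3)) $ k" .
  qed
  show "trisect 2 (euler ^ 3) = 0"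
  proof (rule fps_ext)
    fix k
    have "trisect 2 (euler ^ 3) $ k = (\<Sum>j\<le>3 * k + 2. if 3 * k + 2 = tri j then (-1) ^ j * (2 * int j + 1) else 0)"
      unfolding trisect_nth by (rule euler_cube_nth) simp
    also have "\<dots> = (\<Sum>m\<le>k. 0)"
    proof -
      have "3 * k + 2 \<noteq> tri (3 * m)" "3 * k + 2 \<noteq> tri (3 * m + 1)" "3 * k + 2 \<noteq> tri (3 * m + 2)" for m
        using t[of m] by presburger+
      then show ?thesis unfolding sum_atMost_mult_3 by (intro sum.cong) simp_all
    qed
    finally show "trisect 2 (euler ^ 3) $ k = 0 $ k" by simp
  qed
qed

abbreviation euler3 :: "int fps" where
  "euler3 \<equiv> euler oo fps_X ^ 3"

text \<open>The norm of f_1^3 is computed twice: from its components, one of which is zero, and by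
  multiplicativity.\<close>

lemma trisect_0_euler_cube:
  "trisect 0 (euler ^ 3) ^ 3 * euler3 ^ 3 = euler ^ 12 + 27 * fps_X * euler3 ^ 12"
proof -
  have "(trisect 0 (euler ^ 3) ^ 3 - 27 * fps_X * euler3 ^ 9) * euler3 ^ 3
      = cubic_norm (euler ^ 3) * euler3 ^ 3"
    by (simp only: cubic_norm_def trisect_euler_cube dilate_power)
       (simp add: power_mult_distrib mult.assoc flip: power_mult)
  also have "\<dots> = (cubic_norm euler * euler3) ^ 3"
    by (simp add: cubic_norm_power power_mult_distrib)
  also have "\<dots> = euler ^ 12"
    by (simp add: cubic_norm_euler flip: power_mult)
  finally show ?thesis
    by (simp add: algebra_simps flip: power_add)
qed

text \<open>In these residue classes the component \<open>a\<close> of f_1^3 occurs only as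
  \<open>a ^ 3\<close>, which \<open>trisect_0_euler_cube\<close> eliminates.\<close>

lemma trisect_euler_power:
  "trisect 2 (euler ^ 15) = 90 * euler ^ 12 * euler3 ^ 3 + 2187 * fps_X * euler3 ^ 15"
  "trisect 1 (euler ^ 12) = - 12 * euler ^ 12 - 243 * fps_X * euler3 ^ 12"
proof -
  define u where "u = euler ^ 3"
  define a g where "a = trisect 0 u" and "g = euler3"
  have u: "trisect 0 u = a" "trisect 1 u = - 3 * g ^ 3" "trisect 2 u = 0"
    using trisect_euler_cube by (simp_all add: a_def g_def u_def dilate_power)
  have u2: "trisect 0 (u * u) = a\<^sup>2" "trisect 1 (u * u) = - 6 * a * g ^ 3"
    "trisect 2 (u * u) = 9 * g ^ 6"
    unfolding trisect_mult u by algebra+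
  have u4: "trisect 0 (u * u * (u * u)) = a ^ 4 - 108 * fps_X * a * g ^ 9"
    "trisect 1 (u * u * (u * u)) = - 12 * a ^ 3 * g ^ 3 + 81 * fps_X * g ^ 12"
    "trisect 2 (u * u * (u * u)) = 54 * a\<^sup>2 * g ^ 6"
    unfolding trisect_mult[of "u * u" "u * u"] u2 by algebra+
  have u5: "trisect 2 (u * u * (u * u) * u) = 90 * a ^ 3 * g ^ 6 - 243 * fps_X * g ^ 15"
    unfolding trisect_mult(3)[of "u * u * (u * u)" u] u u4 by algebra
  have a: "a ^ 3 * g ^ 3 = euler ^ 12 + 27 * fps_X * g ^ 12"
    using trisect_0_euler_cube by (simp add: a_def u_def g_def)
  have p: "euler ^ 15 = u * u * (u * u) * u" "euler ^ 12 = u * u * (u * u)"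
    by (simp_all add: u_def flip: power_add)
  have "trisect 1 (euler ^ 12) = - 12 * (a ^ 3 * g ^ 3) + 81 * fps_X * g ^ 12"
    unfolding p u4 by (simp add: mult.assoc)
  then show "trisect 1 (euler ^ 12) = - 12 * euler ^ 12 - 243 * fps_X * euler3 ^ 12"
    unfolding a unfolding g_def by (simp add: algebra_simps)
  have "trisect 2 (euler ^ 15) = 90 * (a ^ 3 * g ^ 3) * g ^ 3 - 243 * fps_X * g ^ 15"
    unfolding p u5 by algebra
  then show "trisect 2 (euler ^ 15) = 90 * euler ^ 12 * euler3 ^ 3 + 2187 * fps_X * euler3 ^ 15"
    unfolding a unfolding g_def[symmetric] by algebra
qed

lemma trisect_2_1_2_euler_power:
  "trisect 2 (trisect 1 (trisect 2 (euler ^ 15)))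
     = 17 * (9720 * euler ^ 12 * euler3 ^ 3) + 2421009 * (fps_X * euler3 ^ 15)"
proof -
  have d: "trisect 1 (F * euler3 ^ n) = trisect 1 F * euler ^ n"
     "trisect 2 (F * euler3 ^ n) = trisect 2 F * euler ^ n" for F n
    by (simp_all add: trisect_mult_dilate flip: dilate_power)
  have z: "trisect 0 (euler3 ^ n) = euler ^ n" for n
    by (simp add: trisect_dilate flip: dilate_power)
  have "trisect 1 (trisect 2 (euler ^ 15))
      = 90 * (trisect 1 (euler ^ 12) * euler ^ 3) + 2187 * euler ^ 15"
    unfolding trisect_euler_power(1) trisect_add mult.assoc trisect_numeral_mult trisect_X_mult z
    by (simp only: d)
  \<comment> \<open>Here 1107 = 2187 - 90 * 12 and 21870 = 90 * 243.\<close>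
  also have "\<dots> = 1107 * euler ^ 15 - 21870 * (fps_X * (euler ^ 3 * euler3 ^ 12))"
    unfolding trisect_euler_power(2) by algebra
  finally have *: "trisect 1 (trisect 2 (euler ^ 15))
      = 1107 * euler ^ 15 - 21870 * (fps_X * (euler ^ 3 * euler3 ^ 12))" .
  have "trisect 2 (trisect 1 (trisect 2 (euler ^ 15)))
      = 1107 * trisect 2 (euler ^ 15) - 21870 * (- 3 * euler3 ^ 3 * euler ^ 12)"
    unfolding * trisect_diff trisect_numeral_mult trisect_X_mult unfolding d trisect_euler_cube
    by (simp add: dilate_power)
  \<comment> \<open>The prime 17 enters here: 1107 * 90 + 21870 * 3 = 165240 = 17 * 9720. The other
    coefficient, 1107 * 2187, is prime to 17.\<close>
  also have "\<dots> = 17 * (9720 * euler ^ 12 * euler3 ^ 3) + 2421009 * (fps_X * euler3 ^ 15)"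
    unfolding trisect_euler_power(1) by algebra
  finally show ?thesis .
qed


section \<open>Generating functions of regular bipartitions\<close>

definition partitions_in :: "nat set \<Rightarrow> nat \<Rightarrow> nat multiset set" where
  "partitions_in S n = {p. set_mset p \<subseteq> S \<and> sum_mset p = n}"

definition partition_gf :: "nat set \<Rightarrow> int fps" where
  "partition_gf S = Abs_fps (\<lambda>n. int (card (partitions_in S n)))"

lemma finite_partitions_in: "0 \<notin> S \<Longrightarrow> finite (partitions_in S n)"
  by (rule finite_subset[OF _ finite_partitions_le[of n]])
     (auto simp: partitions_in_def is_partition_def)

text \<open>A partition either avoids the part \<open>m\<close> or arises from a unique smaller one
  by adding a copy of \<open>m\<close>.\<close>

lemma partition_gf_insert:
  assumes "0 \<notin> S" "m \<notin> S" "m > 0"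
  shows "partition_gf (insert m S) = partition_gf S + fps_X ^ m * partition_gf (insert m S)"
proof (rule fps_ext)
  fix n
  have fin: "finite (partitions_in S n)" "finite (partitions_in (insert m S) k)" for k
    using assms by (auto intro: finite_partitions_in)
  show "partition_gf (insert m S) $ n = (partition_gf S + fps_X ^ m * partition_gf (insert m S)) $ n"
  proof (cases "n < m")
    case True
    have "partitions_in (insert m S) n = partitions_in S n"
      using True by (auto simp: partitions_in_def dest!: multi_member_split)
    then show ?thesis using True by (simp add: partition_gf_def fps_X_power_mult_nth)
  next
    case False
    have "partitions_in (insert m S) n
        = partitions_in S n \<union> add_mset m ` partitions_in (insert m S) (n - m)" (is "?L = ?R")
    proof
      show "?L \<subseteq> ?R"
      proof
        fix p assume p: "p \<in> ?L"
        show "p \<in> ?R"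
        proof (cases "m \<in># p")
          case True
          then obtain q where "p = add_mset m q" by (blast dest: multi_member_split)
          then show ?thesis using p by (auto simp: partitions_in_def)
        qed (use p in \<open>auto simp: partitions_in_def\<close>)
      qed
    qed (use False in \<open>auto simp: partitions_in_def\<close>)
    moreover have "partitions_in S n \<inter> add_mset m ` partitions_in (insert m S) (n - m) = {}"
    proof (rule equals0I)
      fix p assume p: "p \<in> partitions_in S n \<inter> add_mset m ` partitions_in (insert m S) (n - m)"
      then have "m \<in># p" by auto
      then show False using p assms(2) unfolding partitions_in_def by blast
    qed
    ultimately have "card (partitions_in (insert m S) n)
        = card (partitions_in S n) + card (partitions_in (insert m S) (n - m))"
      using fin by (simp add: card_Un_disjoint card_image inj_on_def)
    then show ?thesis using False by (simp add: partition_gf_def fps_X_power_mult_nth)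
  qed
qed

lemma partition_gf_finite:
  "finite S \<Longrightarrow> 0 \<notin> S \<Longrightarrow> partition_gf S * (\<Prod>m\<in>S. 1 - fps_X ^ m) = 1"
proof (induction S rule: finite_induct)
  case empty
  have "partitions_in {} n = (if n = 0 then {{#}} else {})" for n
    by (auto simp: partitions_in_def)
  then show ?case by (simp add: partition_gf_def fps_eq_iff)
next
  case (insert m S)
  have "partition_gf (insert m S) * (1 - fps_X ^ m) = partition_gf S"
    using partition_gf_insert[of S m] insert by (simp add: algebra_simps)
  then have "partition_gf (insert m S) * (\<Prod>m\<in>insert m S. 1 - fps_X ^ m)
      = partition_gf S * (\<Prod>m\<in>S. 1 - fps_X ^ m)"
    by (simp only: prod.insert[OF insert.hyps] mult.assoc[symmetric])
  also have "\<dots> = 1"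
    using insert.IH insert.prems by simp
  finally show ?case .
qed

text \<open>No part exceeds the sum, so coefficients up to \<open>N\<close> only see the finitely
  many parts up to \<open>N\<close>.\<close>

lemma fps_agree_partition_gf:
  "fps_agree (Suc N) (partition_gf S) (partition_gf (S \<inter> {..N}))"
proof -
  have "x \<le> sum_mset p" if "x \<in># p" for x and p :: "nat multiset"
    using that by (auto dest!: multi_member_split)
  then have "partitions_in S i = partitions_in (S \<inter> {..N}) i" if "i < Suc N" for i
    using that by (fastforce simp: partitions_in_def)
  then show ?thesis by (simp add: fps_agree_def partition_gf_def)
qed

lemma qfact_split_dvd:
  assumes "s > 0"
  shows "(\<Prod>m\<in>{m. \<not> s dvd m} \<inter> {..s * n}. 1 - fps_X ^ m) * (qfact n oo fps_X ^ s) = qfact (s * n)"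
proof -
  have "qfact n oo fps_X ^ s = (\<Prod>m=1..n. 1 - fps_X ^ (s * m))"
  proof (induction n)
    case (Suc n)
    then show ?case
      using assms
      by (simp add: qfact_Suc dilate_mult fps_compose_sub_distrib dilate_X_power del: power_Suc)
  qed simp
  also have "\<dots> = (\<Prod>m\<in>(*) s ` {1..n}. 1 - fps_X ^ m)"
    using assms by (subst prod.reindex) (auto simp: inj_on_def)
  also have "(*) s ` {1..n} = {m \<in> {1..s * n}. s dvd m}"
    using assms by (auto elim!: dvdE intro!: Suc_leI)
  finally have *: "qfact n oo fps_X ^ s = (\<Prod>m\<in>{m \<in> {1..s * n}. s dvd m}. 1 - fps_X ^ m)" .
  \<comment> \<open>Zero drops out on the left because it is divisible by \<open>s\<close>.\<close>
  have "{m. \<not> s dvd m} \<inter> {..s * n} = {m \<in> {1..s * n}. \<not> s dvd m}"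
    by (auto intro!: Suc_leI gr0I)
  moreover have "{1..s * n} = {m \<in> {1..s * n}. \<not> s dvd m} \<union> {m \<in> {1..s * n}. s dvd m}"
    by auto
  then have "qfact (s * n) = (\<Prod>m\<in>{m \<in> {1..s * n}. \<not> s dvd m}. 1 - fps_X ^ m)
      * (\<Prod>m\<in>{m \<in> {1..s * n}. s dvd m}. 1 - fps_X ^ m)"
    unfolding qfact_def by (metis (mono_tags, lifting) prod.union_disjoint finite_Un finite_atLeastAtMost disjoint_iff mem_Collect_eq)
  ultimately show ?thesis
    unfolding * by simp
qed

text \<open>The generating function of s-regular partitions is f_s / f_1: up to any order it is the
  inverse of a finite product, completed to \<open>qfact (s * N)\<close> by the multiples of
  \<open>s\<close>.\<close>

lemma partition_gf_not_dvd:
  assumes "s > 0"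
  shows "partition_gf {m. \<not> s dvd m} * euler = euler oo fps_X ^ s"
proof (rule fps_agree_imp_eq)
  fix N
  let ?S = "{m. \<not> s dvd m}"
  have le: "N \<le> s * N" "N \<le> Suc (s * N)" using assms by (simp_all add: le_SucI)
  have "fps_agree N (partition_gf ?S * euler)
      (partition_gf (?S \<inter> {..s * N}) * qfact (s * N))"
    using le by (intro fps_agree_mult fps_agree_mono[OF fps_agree_partition_gf]
        fps_agree_mono[OF fps_agree_euler]) auto
  also have "partition_gf (?S \<inter> {..s * N}) * qfact (s * N) = qfact N oo fps_X ^ s"
    using partition_gf_finite[of "?S \<inter> {..s * N}"] qfact_split_dvd[OF assms, of N]
    by (simp add: mult.assoc[symmetric] flip: qfact_split_dvd[OF assms])
  also have "fps_agree (s * N) (qfact N oo fps_X ^ s) (euler oo fps_X ^ s)"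
    by (intro fps_agree_dilate fps_agree_sym[OF fps_agree_mono[OF fps_agree_euler]] assms) simp
  then have "fps_agree N (qfact N oo fps_X ^ s) (euler oo fps_X ^ s)"
    using le(1) by (rule fps_agree_mono)
  finally show "fps_agree N (partition_gf ?S * euler) (euler oo fps_X ^ s)" .
qed

text \<open>Sorting the pairs by the sum of the first partition gives a Cauchy product.\<close>

lemma regular_bipartitions_gf:
  "Abs_fps (\<lambda>n. int (B s t n)) = partition_gf {m. \<not> s dvd m} * partition_gf {m. \<not> t dvd m}"
proof (rule fps_ext)
  fix n
  let ?P = "\<lambda>s. partitions_in {m. \<not> s dvd m}"
  have "regular_bipartitions s t n = (\<Union>i\<in>{0..n}. ?P s i \<times> ?P t (n - i))"
    by (fastforce simp: regular_bipartitions_def partitions_in_def is_partition_def)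
  then have "B s t n = (\<Sum>i=0..n. card (?P s i \<times> ?P t (n - i)))"
    unfolding B_def
    by (simp only:) (intro card_UN_disjoint ballI impI finite_cartesian_product finite_partitions_in,
      auto simp: partitions_in_def)
  then show "Abs_fps (\<lambda>n. int (B s t n)) $ n
      = (partition_gf {m. \<not> s dvd m} * partition_gf {m. \<not> t dvd m}) $ n"
    by (simp add: fps_mult_nth partition_gf_def card_cartesian_product)
qed

section \<open>Congruences modulo a prime\<close>

lemma fps_const_dvd_iff:
  fixes F :: "int fps"
  shows "fps_const c dvd F \<longleftrightarrow> (\<forall>n. c dvd F $ n)"
proof
  assume "\<forall>n. c dvd F $ n"
  then have "F = fps_const c * Abs_fps (\<lambda>n. F $ n div c)"
    by (simp add: fps_eq_iff)
  then show "fps_const c dvd F" by (rule dvdI)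
qed (auto elim!: dvdE)

lemma prime_dvd_power_diff:
  fixes x y :: "'a :: comm_ring_1"
  assumes "prime p"
  shows "of_nat p dvd (x - y) ^ p - (x ^ p - y ^ p)"
proof -
  have p: "p > 0" using assms prime_gt_0_nat by blast
  have add: "of_nat p dvd (a + b) ^ p - (a ^ p + b ^ p)" for a b :: 'a
  proof -
    have "{..p} = insert 0 (insert p {1..<p})" using p by auto
    then have "(a + b) ^ p - (a ^ p + b ^ p) = (\<Sum>k=1..<p. of_nat (p choose k) * a ^ k * b ^ (p - k))"
      using p by (simp add: binomial_ring)
    also have "of_nat p dvd \<dots>"
    proof (intro dvd_sum dvd_mult2)
      fix k assume "k \<in> {1..<p}"
      then have "p dvd (p choose k)"
        using assms by (intro dvd_choose_prime) auto
      then show "of_nat p dvd (of_nat (p choose k) :: 'a)"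
        by (auto elim!: dvdE)
    qed
    finally show ?thesis .
  qed
  \<comment> \<open>Applying the sum version to x = (x - y) + y avoids the sign (-1)^p and covers p
    = 2 as well.\<close>
  have "(x - y) ^ p - (x ^ p - y ^ p) = - (((x - y) + y) ^ p - ((x - y) ^ p + y ^ p))"
    by simp
  also have "of_nat p dvd \<dots>"
    using add by (simp only: dvd_minus_iff)
  finally show ?thesis .
qed

text \<open>The Frobenius congruence f_1^p = f_p modulo p, obtained factor by factor for the finite
  products and carried over to each coefficient.\<close>

lemma prime_dvd_euler_power:
  assumes "prime p"
  shows "of_nat p dvd euler ^ p - (euler oo fps_X ^ p)"
proof -
  have p: "p > 0" using assms prime_gt_0_nat by blast
  have q: "of_nat p dvd qfact n ^ p - (qfact n oo fps_X ^ p)" for n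
  proof (induction n)
    case (Suc n)
    define a b a' b' :: "int fps" where ab: "a = qfact n" "b = 1 - fps_X ^ Suc n"
      "a' = qfact n oo fps_X ^ p" "b' = b oo fps_X ^ p"
    have "of_nat p dvd b ^ p - b'"
      using prime_dvd_power_diff[OF assms, of 1 "fps_X ^ Suc n :: int fps"] p
      by (simp add: ab fps_compose_sub_distrib dilate_X_power mult.commute[of p] power_mult
          del: power_Suc mult_Suc mult_Suc_right)
    moreover have "of_nat p dvd a ^ p - a'"
      using Suc.IH by (simp add: ab)
    ultimately have "of_nat p dvd (a ^ p - a') * b ^ p + a' * (b ^ p - b')"
      by (intro dvd_add dvd_mult dvd_mult2)
    also have "\<dots> = qfact (Suc n) ^ p - (qfact (Suc n) oo fps_X ^ p)"
      unfolding qfact_Suc dilate_mult[OF p] power_mult_distrib ab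
      by (simp only: left_diff_distrib right_diff_distrib) simp
    finally show ?case .
  qed simp
  have "int p dvd (euler ^ p - (euler oo fps_X ^ p)) $ i" for i
  proof -
    have "fps_agree (p * Suc i) (euler oo fps_X ^ p) (qfact i oo fps_X ^ p)"
      by (intro fps_agree_dilate fps_agree_euler p)
    then have "fps_agree (Suc i) (euler oo fps_X ^ p) (qfact i oo fps_X ^ p)"
      by (rule fps_agree_mono) (use p in \<open>simp del: mult_Suc_right\<close>)
    then have "fps_agree (Suc i) (euler ^ p - (euler oo fps_X ^ p)) (qfact i ^ p - (qfact i oo fps_X ^ p))"
      by (intro fps_agree_diff fps_agree_power fps_agree_euler)
    then show ?thesis
      using q[of i] unfolding fps_of_nat[symmetric] fps_const_dvd_iff by (simp add: fps_agree_def)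
  qed
  then show ?thesis
    by (simp add: fps_const_dvd_iff flip: fps_of_nat)
qed

lemma trisect_dvd: "17 dvd F \<Longrightarrow> 17 dvd trisect r F"
  by (simp add: numeral_fps_const fps_const_dvd_iff)

text \<open>The quotient f_243 f_17 / f_1^2 is handled after multiplication by f_1^2, where f_17 may
  be replaced by f_1^17; the unit f_1^2 is then cancelled.\<close>

lemma B_243_17_gf:
  "17 dvd Abs_fps (\<lambda>n. int (B 243 17 n)) - euler ^ 15 * (euler oo fps_X ^ 243)"
proof -
  let ?G = "Abs_fps (\<lambda>n. int (B 243 17 n))"
  have gf: "?G * euler\<^sup>2 = (euler oo fps_X ^ 243) * (euler oo fps_X ^ 17)"
    using partition_gf_not_dvd[of 243] partition_gf_not_dvd[of 17]
    unfolding regular_bipartitions_gf by (simp add: power2_eq_square ac_simps flip: partition_gf_not_dvd)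
  have "prime (17 :: nat)" by simp
  then have "17 dvd euler ^ 17 - (euler oo fps_X ^ 17)"
    using prime_dvd_euler_power[of 17] by simp
  then have "17 dvd - (euler oo fps_X ^ 243) * (euler ^ 17 - (euler oo fps_X ^ 17))"
    by (rule dvd_mult)
  also have "\<dots> = (?G - euler ^ 15 * (euler oo fps_X ^ 243)) * euler\<^sup>2"
    unfolding left_diff_distrib gf by (simp add: algebra_simps flip: power_add)
  finally have *: "17 dvd (?G - euler ^ 15 * (euler oo fps_X ^ 243)) * euler\<^sup>2" .
  obtain K where K: "euler\<^sup>2 * K = 1"
    using int_fps_unit[of "euler\<^sup>2"] by (auto simp: fps_nth_power_0)
  have "17 dvd (?G - euler ^ 15 * (euler oo fps_X ^ 243)) * euler\<^sup>2 * K"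
    using * by (rule dvd_mult2)
  then show ?thesis using K by (simp add: mult.assoc)
qed

theorem theorem1p4:
  fixes n :: nat
  shows "[B 243 17 (81 * n + 23) = 0] (mod 17) \<and> [B 243 17 (81 * n + 77) = 0] (mod 17)"
proof -
  let ?G = "Abs_fps (\<lambda>n. int (B 243 17 n))"
  \<comment> \<open>This extracts the exponents 81n + 27r + 23, that is 23 for r = 0 and 77 for r =
    2.\<close>
  let ?T = "\<lambda>r F. trisect r (trisect 2 (trisect 1 (trisect 2 F)))"
  have main: "17 dvd ?T r ?G" if r: "r = 0 \<or> r = 2" for r
  proof -
    \<comment> \<open>All exponents of this series are 1 modulo 3, so it only contributes to the
      excluded case r = 1.\<close>
    have z: "trisect r (fps_X * euler3 ^ 15) = 0"
      using r trisect_dilate by (auto simp: trisect_X_mult simp flip: dilate_power)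
    have "?T r (euler ^ 15) = 17 * (9720 * trisect r (euler ^ 12 * euler3 ^ 3))"
      unfolding trisect_2_1_2_euler_power trisect_add mult.assoc trisect_numeral_mult z by simp
    then have "17 dvd ?T r (euler ^ 15)" by (rule dvdI)
    moreover have "?T r (euler ^ 15 * (euler oo fps_X ^ 243)) = ?T r (euler ^ 15) * (euler oo fps_X ^ 3)"
    proof -
      \<comment> \<open>Since 243 = 3^5, the four trisections undo four of the five dilations and
        leave f_3.\<close>
      have d: "euler oo fps_X ^ 243 = (((euler oo fps_X ^ 3) oo fps_X ^ 3) oo fps_X ^ 3) oo fps_X ^ 3 oo fps_X ^ 3"
        by (simp add: dilate_dilate)
      show ?thesis
        unfolding d using r by (auto simp: trisect_mult_dilate)
    qed
    ultimately have "17 dvd ?T r (euler ^ 15 * (euler oo fps_X ^ 243))" by simp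
    moreover have "17 dvd ?T r (?G - euler ^ 15 * (euler oo fps_X ^ 243))"
      by (intro trisect_dvd B_243_17_gf)
    ultimately show ?thesis
      unfolding trisect_diff by (simp add: dvd_diff_left_iff)
  qed
  have "17 dvd B 243 17 (3 * (3 * (3 * (3 * n + r) + 2) + 1) + 2)" if "r = 0 \<or> r = 2" for r
  proof -
    have "int 17 dvd int (B 243 17 (3 * (3 * (3 * (3 * n + r) + 2) + 1) + 2))"
      using main[OF that] by (simp add: numeral_fps_const fps_const_dvd_iff)
    then show ?thesis by (simp only: int_dvd_int_iff)
  qed
  from this[of 0] this[of 2] show ?thesis
    by (simp add: cong_0_iff algebra_simps)
qed

end
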